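(* For every $(x,y)\in D\left(\frac{\pi}{4}\right)$ and every $P\in\mathcal{P}\left(^2D\left(\frac{\pi}{4}\right)\right)$ we have $$ \|\nabla P(x,y)\|_2\leq \Phi(x,y)\,\|P\|_{D\left(\frac{\pi}{4}\right)}, $$ where $$ \Phi(x,y)=\begin{cases} 4\left[\left(13+8\sqrt{2}\right)x^2+\left(69+48\sqrt{2}\right)y^2-2\left(28+20\sqrt{2}\right)xy\right] & \text{if } 0\leq y \leq \frac{\sqrt{2}-1}{2}x \text{ or } \left(4\sqrt{2}-5\right)x\leq y \leq x,\\[4pt] \dfrac{x^4}{y^2}+4(x^2+y^2) & \text{if } \frac{\sqrt{2}-1}{2}x \leq y \leq \left(\sqrt{2}-1\right)x,\\[8pt] \dfrac{\left(3x^2-2xy+3y^2\right)^2}{2(x-y)^2} & \text{if } \left(\sqrt{2}-1\right)x\leq y \leq \left(4\sqrt{2}-5\right)x. \end{cases} $$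
   Context: $D\left(\frac{\pi}{4}\right):=\left\{e^{i\theta}:\theta\in\left[0,\frac{\pi}{4}\right]\right\}$, viewed as a subset of $\mathbb{R}^2$. $\mathcal{P}\left(^2D\left(\frac{\pi}{4}\right)\right)$ is the space of real $2$-homogeneous polynomials $P(x,y)=ax^2+by^2+cxy$ on $\mathbb{R}^2$ ($a,b,c\in\mathbb{R}$) endowed with the norm $\|P\|_{D\left(\frac{\pi}{4}\right)}=\sup\left\{|P(x,y)|:(x,y)\in D\left(\frac{\pi}{4}\right)\right\}$. $\nabla P$ is the gradient of $P$ and $\|\cdot\|_2$ is the Euclidean norm on $\mathbb{R}^2$. *)

theory Defs
  imports "HOL-Analysis.Analysis"
begin

text \<open>
  The plane is the type \<^typ>\<open>real \<times> real\<close>, whose library norm and inner product are the Euclidean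
  ones. The set \<open>D4\<close> consists of unit vectors only; it is not the filled circular sector.
\<close>

definition D4 :: "(real \<times> real) set" where
  "D4 = (\<lambda>z. (Re z, Im z)) ` {cis \<theta> | \<theta>. 0 \<le> \<theta> \<and> \<theta> \<le> pi / 4}"

definition quad_polys :: "(real \<times> real \<Rightarrow> real) set" where
  "quad_polys = {P. \<exists>a b c. \<forall>x y. P (x, y) = a * x\<^sup>2 + b * y\<^sup>2 + c * x * y}"

definition D4_norm :: "(real \<times> real \<Rightarrow> real) \<Rightarrow> real" where
  "D4_norm P = (SUP z\<in>D4. \<bar>P z\<bar>)"

definition gradient :: "(real \<times> real \<Rightarrow> real) \<Rightarrow> real \<times> real \<Rightarrow> real \<times> real" where
  "gradient f z = (THE g. GDERIV f z :> g)"

lemma gradient_eqI: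
  assumes "GDERIV f z :> g"
  shows "gradient f z = g"
  unfolding gradient_def
proof (rule the_equality)
  show "GDERIV f z :> g" by (rule assms)
next
  fix g' assume "GDERIV f z :> g'"
  then have "(\<lambda>h. h \<bullet> g') = (\<lambda>h. h \<bullet> g)"
    using assms unfolding gderiv_def by (rule has_derivative_unique)
  then show "g' = g" by (metis vector_eq_rdot inner_commute)
qed

lemma gradient_quad_poly:
  assumes "\<And>x y. P (x, y) = a * x\<^sup>2 + b * y\<^sup>2 + c * x * y"
  shows "gradient P (x, y) = (2 * a * x + c * y, 2 * b * y + c * x)"
proof (rule gradient_eqI)
  have P: "P = (\<lambda>z. a * (fst z)\<^sup>2 + b * (snd z)\<^sup>2 + c * fst z * snd z)"
    using assms by auto
  show "GDERIV P (x, y) :> (2 * a * x + c * y, 2 * b * y + c * x)"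
    unfolding gderiv_def P
    by (auto intro!: derivative_eq_intros simp: fun_eq_iff inner_prod_def algebra_simps)
qed

text \<open>
  The three cases share their boundary lines, where the adjacent formulas agree (see
  \<open>Phi_boundary\<close>), so the order of the tests is immaterial. The function is only
  meaningful for \<open>0 \<le> y \<le> x\<close> and \<open>x > 0\<close>, which covers \<open>D4\<close>.
\<close>

definition Phi1 :: "real \<Rightarrow> real \<Rightarrow> real" where
  "Phi1 x y = 4 * ((13 + 8 * sqrt 2) * x\<^sup>2 + (69 + 48 * sqrt 2) * y\<^sup>2
                    - 2 * (28 + 20 * sqrt 2) * x * y)"

definition Phi2 :: "real \<Rightarrow> real \<Rightarrow> real" where
  "Phi2 x y = x ^ 4 / y\<^sup>2 + 4 * (x\<^sup>2 + y\<^sup>2)"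

definition Phi3 :: "real \<Rightarrow> real \<Rightarrow> real" where
  "Phi3 x y = (3 * x\<^sup>2 - 2 * x * y + 3 * y\<^sup>2)\<^sup>2 / (2 * (x - y)\<^sup>2)"

definition Phi :: "real \<Rightarrow> real \<Rightarrow> real" where
  "Phi x y =
     (if (0 \<le> y \<and> y \<le> (sqrt 2 - 1) / 2 * x) \<or> ((4 * sqrt 2 - 5) * x \<le> y \<and> y \<le> x)
      then Phi1 x y
      else if (sqrt 2 - 1) / 2 * x \<le> y \<and> y \<le> (sqrt 2 - 1) * x
      then Phi2 x y
      else if (sqrt 2 - 1) * x \<le> y \<and> y \<le> (4 * sqrt 2 - 5) * x
      then Phi3 x y
      else undefined)"

lemma Phi_boundary:
  fixes x :: real
  assumes "x > 0"
  shows "Phi1 x ((sqrt 2 - 1) / 2 * x) = Phi2 x ((sqrt 2 - 1) / 2 * x)"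
    and "Phi2 x ((sqrt 2 - 1) * x) = Phi3 x ((sqrt 2 - 1) * x)"
    and "Phi3 x ((4 * sqrt 2 - 5) * x) = Phi1 x ((4 * sqrt 2 - 5) * x)"
proof -
  define s :: real where "s = sqrt 2"
  have s2: "s * s = 2" by (simp add: s_def)
  have s1: "s > 1" by (simp add: s_def)
  have s3: "s < 3/2" unfolding s_def by (rule real_less_lsqrt) (simp_all add: power2_eq_square)
  have q: "((s - 1) / 2)\<^sup>2 = (3 - 2 * s) / 4" "(s - 1)\<^sup>2 = 3 - 2 * s" "(4 * s - 5)\<^sup>2 = 57 - 40 * s"
    using s2 by (simp_all add: power2_eq_square algebra_simps)
  have pos: "3 - 2 * s > 0" using s3 by simp
  have i: "1 / (3 - 2 * s) = 3 + 2 * s"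
    using pos s2 by (simp add: field_simps)
  have P1: "Phi1 x (t * x) = x\<^sup>2 * (4 * ((13 + 8 * s) + (69 + 48 * s) * t\<^sup>2 - 2 * (28 + 20 * s) * t))" for t
    by (simp add: Phi1_def s_def algebra_simps power2_eq_square)
  have P2: "Phi2 x (t * x) = x\<^sup>2 * (1 / t\<^sup>2 + 4 * (1 + t\<^sup>2))" if "t \<noteq> 0" for t
    using that assms by (simp add: Phi2_def field_simps power2_eq_square power4_eq_xxxx)
  have P3: "Phi3 x (t * x) = x\<^sup>2 * ((3 - 2 * t + 3 * t\<^sup>2)\<^sup>2 / (2 * (1 - t)\<^sup>2))" if "t \<noteq> 1" for t
  proof -
    have "(3 * x\<^sup>2 - 2 * x * (t * x) + 3 * (t * x)\<^sup>2)\<^sup>2 = x\<^sup>2 * x\<^sup>2 * (3 - 2 * t + 3 * t\<^sup>2)\<^sup>2"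
         "2 * (x - t * x)\<^sup>2 = x\<^sup>2 * (2 * (1 - t)\<^sup>2)"
      by (simp_all add: algebra_simps power2_eq_square)
    then have "Phi3 x (t * x) = (x\<^sup>2 * (x\<^sup>2 * (3 - 2 * t + 3 * t\<^sup>2)\<^sup>2)) / (x\<^sup>2 * (2 * (1 - t)\<^sup>2))"
      by (simp only: Phi3_def mult.assoc)
    also have "\<dots> = (x\<^sup>2 * (3 - 2 * t + 3 * t\<^sup>2)\<^sup>2) / (2 * (1 - t)\<^sup>2)"
      using assms by (intro mult_divide_mult_cancel_left) simp
    finally show ?thesis by simp
  qed
  have "4 * ((13 + 8 * s) + (69 + 48 * s) * ((3 - 2 * s) / 4) - 2 * (28 + 20 * s) * ((s - 1) / 2))
        = 4 * (3 + 2 * s) + 4 * (1 + (3 - 2 * s) / 4)"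
    using s2 by (simp add: field_simps)
  moreover have "1 / ((3 - 2 * s) / 4) = 4 * (3 + 2 * s)" using i by simp
  ultimately show "Phi1 x ((sqrt 2 - 1) / 2 * x) = Phi2 x ((sqrt 2 - 1) / 2 * x)"
    using P1[of "(s - 1) / 2"] P2[of "(s - 1) / 2"] s1 s3 unfolding q s_def[symmetric] by simp
  have "(1 - (s - 1))\<^sup>2 = 6 - 4 * s" "(3 - 2 * (s - 1) + 3 * (3 - 2 * s))\<^sup>2 = 324 - 224 * s"
    using s2 by (simp_all add: power2_eq_square algebra_simps)
  moreover have "(324 - 224 * s) / (2 * (6 - 4 * s)) = 1 / (3 - 2 * s) + 4 * (1 + (3 - 2 * s))"
    using pos s2 unfolding i by (simp add: field_simps)
  ultimately show "Phi2 x ((sqrt 2 - 1) * x) = Phi3 x ((sqrt 2 - 1) * x)"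
    using P2[of "s - 1"] P3[of "s - 1"] s1 s3 unfolding q s_def[symmetric] by simp
  have "(1 - (4 * s - 5))\<^sup>2 = 68 - 48 * s"
       "(3 - 2 * (4 * s - 5) + 3 * (57 - 40 * s))\<^sup>2 = (184 - 128 * s)\<^sup>2"
    using s2 by (simp_all add: power2_eq_square algebra_simps)
  moreover have "(184 - 128 * s)\<^sup>2 / (2 * (68 - 48 * s))
      = 4 * ((13 + 8 * s) + (69 + 48 * s) * (57 - 40 * s) - 2 * (28 + 20 * s) * (4 * s - 5))"
  proof -
    have "(68 - 48 * s) = 4 * (3 - 2 * s)\<^sup>2" using s2 by (simp add: power2_eq_square algebra_simps)
    then have "68 - 48 * s \<noteq> 0" using pos by simp
    then show ?thesis using s2 by (simp add: field_simps power2_eq_square)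
  qed
  ultimately show "Phi3 x ((4 * sqrt 2 - 5) * x) = Phi1 x ((4 * sqrt 2 - 5) * x)"
    using P1[of "4 * s - 5"] P3[of "4 * s - 5"] s1 s3 s2 unfolding q s_def[symmetric] by auto
qed

end

theory Submission
  imports Defs
begin

text \<open>
  A quadratic polynomial restricted to the unit circle is
  \<open>m + d * cos \<phi> + e * sin \<phi>\<close> with \<open>\<phi> = 2 * \<theta>\<close>, and \<open>D4\<close> is the arc \<open>0 \<le> \<phi> \<le> pi / 2\<close>. By Euler's identity
  the radial part of the gradient is twice the value of the polynomial, hence at most \<open>2 * N\<close>, where
  \<open>N\<close> is the norm. The tangential part \<open>2 * (e * cos \<phi> - d * sin \<phi>)\<close> is recovered by interpolation
  from the values at \<open>\<phi> = 0, pi / 4, pi / 2\<close>, the points where the extremal (Chebyshev)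
  polynomial of the arc attains \<open>N\<close>, \<open>- N\<close>, \<open>N\<close>. Adding the absolute values of the interpolation
  coefficients bounds the tangential part by \<open>(4 + 4 * sqrt 2) * N\<close> on the whole arc, and by
  \<open>(4 + 2 * sqrt 2) * N\<close> at points that are not too close to its ends.

  The function \<open>Phi\<close> has the size of the square of the gradient of a polynomial of norm \<open>1\<close>, which
  leaves room in an estimate of the gradient itself: these constant bounds are already below \<open>Phi\<close>.
  Indeed \<open>Phi\<close> is at least \<open>6 + 2 * sqrt 2\<close> in the two middle sectors (\<open>Phi2_ge\<close>, \<open>Phi3_ge\<close>), and at
  least \<open>6 + 4 * sqrt 2\<close> in the two outer ones (\<open>Phi1_ge\<close>).
\<close>

section \<open>The arc and its norm\<close>

lemma D4_bounds:
  assumes "(x, y) \<in> D4"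
  shows "x\<^sup>2 + y\<^sup>2 = 1" "0 \<le> y" "y \<le> x" "0 < x"
proof -
  obtain t where t: "0 \<le> t" "t \<le> pi / 4" and xy: "x = cos t" "y = sin t"
    using assms by (auto simp: D4_def)
  show "x\<^sup>2 + y\<^sup>2 = 1" by (simp add: xy)
  show "0 \<le> y" unfolding xy by (rule sin_ge_zero) (use t in auto)
  show "0 < x" unfolding xy by (rule cos_gt_zero_pi) (use t pi_gt_zero in linarith)+
  have "y \<le> sin (pi / 4)"
    unfolding xy by (rule sin_monotone_2pi_le) (use t in auto)
  also have "\<dots> = cos (pi / 4)" by (simp add: sin_45 cos_45)
  also have "\<dots> \<le> x"
    unfolding xy by (rule cos_monotone_0_pi_le) (use t in auto)
  finally show "y \<le> x" .
qed

lemma abs_le_D4_norm: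
  assumes "P \<in> quad_polys" "z \<in> D4"
  shows "\<bar>P z\<bar> \<le> D4_norm P"
proof -
  obtain a b c where P: "\<And>x y. P (x, y) = a * x\<^sup>2 + b * y\<^sup>2 + c * x * y"
    using assms(1) by (auto simp: quad_polys_def)
  have "\<bar>P (x, y)\<bar> \<le> \<bar>a\<bar> + \<bar>b\<bar> + \<bar>c\<bar>" if "(x, y) \<in> D4" for x y
  proof -
    note xy = D4_bounds[OF that]
    have sq: "x\<^sup>2 \<le> 1" "y\<^sup>2 \<le> 1"
      using xy(1) zero_le_power2[of x] zero_le_power2[of y] by linarith+
    have "x * y \<le> x * x" using xy by (intro mult_left_mono) auto
    then have "x * y \<le> 1" using sq(1) by (simp add: power2_eq_square)
    with sq have "\<bar>a * x\<^sup>2\<bar> \<le> \<bar>a\<bar>" "\<bar>b * y\<^sup>2\<bar> \<le> \<bar>b\<bar>" "\<bar>c * (x * y)\<bar> \<le> \<bar>c\<bar>"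
      using xy by (auto simp: abs_mult intro!: mult_left_le)
    then show ?thesis unfolding P mult.assoc by linarith
  qed
  then have "bdd_above ((\<lambda>z. \<bar>P z\<bar>) ` D4)"
    by (intro bdd_aboveI[of _ "\<bar>a\<bar> + \<bar>b\<bar> + \<bar>c\<bar>"]) auto
  then show ?thesis
    unfolding D4_norm_def by (rule cSUP_upper[OF assms(2)])
qed

text \<open>The values at the angles \<open>\<theta> = 0\<close>, \<open>pi / 4\<close> and \<open>pi / 8\<close>, in the coefficients
  \<open>m = (a + b) / 2\<close>, \<open>d = (a - b) / 2\<close>, \<open>e = c / 2\<close> of the trigonometric form.\<close>

lemma D4_norm_samples:
  assumes "\<And>x y. P (x, y) = a * x\<^sup>2 + b * y\<^sup>2 + c * x * y"
  defines "m \<equiv> (a + b) / 2" and "d \<equiv> (a - b) / 2" and "e \<equiv> c / 2"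
  shows "\<bar>m + d\<bar> \<le> D4_norm P" "\<bar>m + e\<bar> \<le> D4_norm P"
    and "\<bar>m + (d + e) * (sqrt 2 / 2)\<bar> \<le> D4_norm P"
proof -
  have quad: "P \<in> quad_polys" using assms(1) by (auto simp: quad_polys_def)
  have sample: "\<bar>m + d * cos (2 * t) + e * sin (2 * t)\<bar> \<le> D4_norm P" if "0 \<le> t" "t \<le> pi / 4" for t
  proof -
    have "(cos t, sin t) \<in> D4" using that by (force simp: D4_def)
    then have "\<bar>P (cos t, sin t)\<bar> \<le> D4_norm P" by (rule abs_le_D4_norm[OF quad])
    moreover have "P (cos t, sin t) = m + d * cos (2 * t) + e * sin (2 * t)"
      unfolding assms(1) cos_double sin_double
      by (simp add: m_def d_def e_def sin_squared_eq field_simps)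
    ultimately show ?thesis by simp
  qed
  show "\<bar>m + d\<bar> \<le> D4_norm P" using sample[of 0] by simp
  show "\<bar>m + e\<bar> \<le> D4_norm P" using sample[of "pi / 4"] by simp
  show "\<bar>m + (d + e) * (sqrt 2 / 2)\<bar> \<le> D4_norm P"
    using sample[of "pi / 8"] by (simp add: sin_45 cos_45 field_simps)
qed

section \<open>The tangential derivative\<close>

text \<open>
  For \<open>c = cos \<phi>\<close>, \<open>s = sin \<phi>\<close> the left side is half of the derivative of
  \<open>m + d * cos (2 * \<theta>) + e * sin (2 * \<theta>)\<close> with respect to \<open>\<theta>\<close>. It is a
  linear combination of the three sampled values, and the first factor on the right is the sum of the
  absolute values of its coefficients: the maximum separates the cases where the coefficients
  of the two end points have equal or opposite signs.
\<close>

lemma tangential_bound: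
  fixes m d e c s N :: real
  assumes "\<bar>m + d\<bar> \<le> N" "\<bar>m + e\<bar> \<le> N" "\<bar>m + (d + e) * (sqrt 2 / 2)\<bar> \<le> N"
    and "0 \<le> c" "0 \<le> s"
  shows "\<bar>e * c - d * s\<bar>
    \<le> max (2 * (1 + sqrt 2) * \<bar>c - s\<bar>) (c + s + (1 + sqrt 2) * \<bar>c - s\<bar>) * N"
proof -
  define r where "r = sqrt (2::real)"
  have r: "r * r = 2" "0 \<le> r" by (simp_all add: r_def)
  define p q w where "p = m + d" and "q = m + e" and "w = m + (d + e) * (r / 2)"
  define A B C where "A = (1 + r / 2) * (s - c) - s" and "B = (1 + r / 2) * (s - c) + c"
    and "C = (1 + r) * (s - c)"
  have sum: "\<bar>A\<bar> + \<bar>B\<bar> + \<bar>C\<bar>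
    \<le> max (2 * (1 + r) * \<bar>c - s\<bar>) (c + s + (1 + r) * \<bar>c - s\<bar>)"
  proof -
    have C: "\<bar>C\<bar> = (1 + r) * \<bar>c - s\<bar>"
      using r by (simp add: C_def abs_mult abs_minus_commute)
    have "A + B = C" "B - A = c + s"
      by (simp_all add: A_def B_def C_def algebra_simps)
    then have "\<bar>A\<bar> + \<bar>B\<bar> \<le> max \<bar>C\<bar> (c + s)"
      using assms(4,5) by linarith
    then show ?thesis unfolding C by (simp add: max_def algebra_simps split: if_splits)
  qed
  have "e * c - d * s = A * p + B * q - C * w"
  proof -
    have C: "C * (r / 2) = (1 + r / 2) * (s - c)"
    proof -
      have "(1 + r) * (r / 2) = 1 + r / 2" using r(1) by (simp add: field_simps)
      then show ?thesis by (metis C_def mult.assoc mult.commute)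
    qed
    have "A * p + B * q - C * w
        = (A + B - C) * m + (A - C * (r / 2)) * d + (B - C * (r / 2)) * e"
      by (simp add: p_def q_def w_def algebra_simps)
    also have "\<dots> = e * c - d * s"
      unfolding C by (simp add: A_def B_def C_def algebra_simps)
    finally show ?thesis ..
  qed
  also have "\<bar>\<dots>\<bar> \<le> \<bar>A\<bar> * \<bar>p\<bar> + \<bar>B\<bar> * \<bar>q\<bar> + \<bar>C\<bar> * \<bar>w\<bar>"
    unfolding abs_mult[symmetric] by linarith
  also have "\<dots> \<le> \<bar>A\<bar> * N + \<bar>B\<bar> * N + \<bar>C\<bar> * N"
    using assms(1-3) by (intro add_mono mult_left_mono) (simp_all add: p_def q_def w_def r_def)
  also have "\<dots> = (\<bar>A\<bar> + \<bar>B\<bar> + \<bar>C\<bar>) * N" by (simp add: algebra_simps)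
  also have "\<dots> \<le> max (2 * (1 + r) * \<bar>c - s\<bar>) (c + s + (1 + r) * \<bar>c - s\<bar>) * N"
    using sum assms(1) by (intro mult_right_mono) auto
  finally show ?thesis unfolding r_def .
qed

text \<open>The radial component of the gradient is twice the value of the polynomial (Euler's identity
  in degree two), the tangential one is estimated by interpolation. The first bound rests on
  \<open>\<bar>cos \<phi> - sin \<phi>\<bar> \<le> 1\<close>; the second one holds for \<open>\<bar>\<phi> - pi / 4\<bar> \<le> pi / 6\<close>.\<close>

lemma gradient_bounds:
  assumes xy: "(x, y) \<in> D4" and P: "P \<in> quad_polys"
  shows "norm (gradient P (x, y)) \<le> (6 + 4 * sqrt 2) * D4_norm P"
    and "\<bar>x\<^sup>2 - y\<^sup>2 - 2 * x * y\<bar> \<le> sqrt 2 / 2 \<Longrightarrow>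
      norm (gradient P (x, y)) \<le> (6 + 2 * sqrt 2) * D4_norm P"
proof -
  obtain a b k where quad: "\<And>x y. P (x, y) = a * x\<^sup>2 + b * y\<^sup>2 + k * x * y"
    using P by (auto simp: quad_polys_def)
  define r N where "r = sqrt (2::real)" and "N = D4_norm P"
  have r: "r * r = 2" "1 \<le> r" by (simp_all add: r_def)
  define c s where "c = x\<^sup>2 - y\<^sup>2" and "s = 2 * x * y"
  define T where "T = k / 2 * c - (a - b) / 2 * s"
  note bds = D4_bounds[OF xy]
  have cs: "0 \<le> c" "0 \<le> s" using bds by (simp_all add: c_def s_def power_mono)
  have circle: "c\<^sup>2 + s\<^sup>2 = 1"
  proof -
    have "c\<^sup>2 + s\<^sup>2 = (x\<^sup>2 + y\<^sup>2)\<^sup>2" by (simp add: c_def s_def power2_eq_square algebra_simps)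
    then show ?thesis by (simp add: bds(1))
  qed
  then have "c\<^sup>2 \<le> 1" "s\<^sup>2 \<le> 1" using zero_le_power2[of c] zero_le_power2[of s] by linarith+
  then have cs1: "c \<le> 1" "s \<le> 1" by (simp_all add: abs_square_le_1 abs_le_iff)
  have T: "\<bar>T\<bar> \<le> max (2 * (1 + r) * \<bar>c - s\<bar>) (c + s + (1 + r) * \<bar>c - s\<bar>) * N"
    unfolding T_def r_def N_def by (rule tangential_bound[OF D4_norm_samples[OF quad] cs])
  have PN: "\<bar>P (x, y)\<bar> \<le> N" unfolding N_def by (rule abs_le_D4_norm[OF P xy])
  then have N: "0 \<le> N" by linarith
  have "(norm (gradient P (x, y)))\<^sup>2 = (2 * P (x, y))\<^sup>2 + (2 * T)\<^sup>2"
  proof -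
    have "(norm (gradient P (x, y)))\<^sup>2
        = ((2 * a * x + k * y)\<^sup>2 + (2 * b * y + k * x)\<^sup>2) * (x\<^sup>2 + y\<^sup>2)"
      by (simp add: gradient_quad_poly[OF quad] norm_Pair bds(1))
    also have "\<dots> = (2 * P (x, y))\<^sup>2 + (2 * T)\<^sup>2"
      unfolding quad T_def c_def s_def by (simp add: power2_eq_square field_simps)
    finally show ?thesis .
  qed
  then have "norm (gradient P (x, y)) = sqrt ((2 * P (x, y))\<^sup>2 + (2 * T)\<^sup>2)"
    by (metis norm_ge_zero real_sqrt_abs abs_of_nonneg)
  also have "\<dots> \<le> \<bar>2 * P (x, y)\<bar> + \<bar>2 * T\<bar>" by (rule sqrt_sum_squares_le_sum_abs)
  also have "\<dots> \<le> 2 * N + 2 * \<bar>T\<bar>" using PN by simp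
  finally have norm_le: "norm (gradient P (x, y)) \<le> 2 * N + 2 * \<bar>T\<bar>" .
  have bound: "norm (gradient P (x, y)) \<le> (2 + 2 * K) * N"
    if "2 * (1 + r) * \<bar>c - s\<bar> \<le> K" "2 + r \<le> K" for K
  proof -
    \<comment> \<open>The sum is \<open>(2 + r) * c - r * s\<close> or \<open>(2 + r) * s - r * c\<close>.\<close>
    have "c + s + (1 + r) * \<bar>c - s\<bar> \<le> (2 + r) * max c s"
    proof (cases "s \<le> c")
      case True
      then have "c + s + (1 + r) * \<bar>c - s\<bar> = (2 + r) * c - r * s" by (simp add: algebra_simps)
      also have "\<dots> \<le> (2 + r) * c" using cs r by simp
      finally show ?thesis using True by (simp add: max_def)
    next
      case False
      then have "c + s + (1 + r) * \<bar>c - s\<bar> = (2 + r) * s - r * c" by (simp add: algebra_simps)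
      also have "\<dots> \<le> (2 + r) * s" using cs r by simp
      finally show ?thesis using False by (simp add: max_def)
    qed
    also have "\<dots> \<le> 2 + r" using cs1 r by (intro mult_left_le) auto
    finally have "max (2 * (1 + r) * \<bar>c - s\<bar>) (c + s + (1 + r) * \<bar>c - s\<bar>) \<le> K"
      using that by simp
    then have "\<bar>T\<bar> \<le> K * N" using T N by (meson mult_right_mono order_trans)
    then show ?thesis using norm_le by (simp add: algebra_simps)
  qed
  have "\<bar>c - s\<bar> \<le> 1" using cs cs1 by linarith
  then have "2 * (1 + r) * \<bar>c - s\<bar> \<le> 2 + 2 * r" using r by (simp add: mult_left_le)
  from bound[OF this] show "norm (gradient P (x, y)) \<le> (6 + 4 * sqrt 2) * D4_norm P"
    using r by (simp add: r_def N_def algebra_simps)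
  assume "\<bar>x\<^sup>2 - y\<^sup>2 - 2 * x * y\<bar> \<le> sqrt 2 / 2"
  then have "2 * (1 + r) * \<bar>c - s\<bar> \<le> 2 * (1 + r) * (r / 2)"
    using r by (intro mult_left_mono) (simp_all add: c_def s_def r_def)
  also have "\<dots> = 2 + r" using r by (simp add: algebra_simps)
  finally show "norm (gradient P (x, y)) \<le> (6 + 2 * sqrt 2) * D4_norm P"
    using bound[of "2 + r"] by (simp add: r_def N_def algebra_simps)
qed

section \<open>Lower bounds for the three pieces\<close>

lemma sqrt2_bounds: "7 / 5 < sqrt (2::real)" "sqrt (2::real) < 142 / 100"
  by (rule real_less_rsqrt, simp add: power2_eq_square)
     (rule real_less_lsqrt, simp_all add: power2_eq_square)

text \<open>As a quadratic form in the slope \<open>y / x\<close>, the difference of the two sides is negative only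
  for slopes between \<open>0.29\<close> and \<open>0.55\<close>; the roots \<open>1 / 4\<close> and \<open>3 / 5\<close> of the comparison form
  separate these slopes from the two outer sectors.\<close>

lemma Phi1_ge:
  assumes "x\<^sup>2 + y\<^sup>2 = 1" "0 \<le> y" "y \<le> x"
    and "y \<le> (sqrt 2 - 1) / 2 * x \<or> (4 * sqrt 2 - 5) * x \<le> y"
  shows "6 + 4 * sqrt 2 \<le> Phi1 x y"
proof -
  define r where "r = sqrt (2::real)"
  have r: "7 / 5 < r" "r < 142 / 100" using sqrt2_bounds by (simp_all add: r_def)
  have x: "0 \<le> x" using assms by linarith
  have "0 \<le> (y - x / 4) * (y - 3 / 5 * x)"
    using assms(4)
  proof
    assume "y \<le> (sqrt 2 - 1) / 2 * x"
    also have "\<dots> \<le> 1 / 4 * x"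
      using r x by (intro mult_right_mono) (simp_all add: r_def)
    finally show ?thesis using x by (intro mult_nonpos_nonpos) auto
  next
    assume "(4 * sqrt 2 - 5) * x \<le> y"
    moreover have "3 / 5 * x \<le> (4 * sqrt 2 - 5) * x"
      using r x by (intro mult_right_mono) (simp_all add: r_def)
    ultimately show ?thesis using x by (intro mult_nonneg_nonneg) auto
  qed
  then have "0 \<le> (270 + 188 * r) * ((y - x / 4) * (y - 3 / 5 * x))"
    by (rule mult_nonneg_nonneg[rotated]) (use r in simp)
  moreover have "0 \<le> (11 / 2 - 1 / 5 * r) * x\<^sup>2 + (11 / 2 - 1 / 5 * r) * (x * y)"
    using r x assms(2) by (intro add_nonneg_nonneg mult_nonneg_nonneg) auto
  moreover have "Phi1 x y - (6 + 4 * r) * (x\<^sup>2 + y\<^sup>2)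
      = (270 + 188 * r) * ((y - x / 4) * (y - 3 / 5 * x))
        + ((11 / 2 - 1 / 5 * r) * x\<^sup>2 + (11 / 2 - 1 / 5 * r) * (x * y))"
    unfolding Phi1_def r_def[symmetric] by (simp add: power2_eq_square field_simps)
  ultimately show ?thesis by (simp add: assms(1) r_def)
qed

lemma Phi2_ge:
  assumes "x\<^sup>2 + y\<^sup>2 = 1" "0 < y" "y \<le> (sqrt 2 - 1) * x"
  shows "6 + 2 * sqrt 2 \<le> Phi2 x y"
proof -
  define r where "r = sqrt (2::real)"
  have r: "r * r = 2" "7 / 5 < r" "r < 142 / 100"
    using sqrt2_bounds by (simp_all add: r_def)
  have "y\<^sup>2 \<le> ((r - 1) * x)\<^sup>2"
    using assms(2,3) by (intro power_mono) (simp_all add: r_def)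
  also have "\<dots> = (3 - 2 * r) * x\<^sup>2"
    using r(1) by (simp add: power2_eq_square algebra_simps)
  finally have slope: "y\<^sup>2 \<le> (3 - 2 * r) * x\<^sup>2" .
  have x2: "2 * r - 2 \<le> x\<^sup>2"
  proof -
    have "1 \<le> (4 - 2 * r) * x\<^sup>2" using slope assms(1) by (simp add: algebra_simps)
    then have "(2 + r) * 1 \<le> (2 + r) * ((4 - 2 * r) * x\<^sup>2)"
      using r(2) by (intro mult_left_mono) auto
    also have "\<dots> = 4 * x\<^sup>2" using r(1) by (simp add: algebra_simps)
    finally show ?thesis using r(3) by simp
  qed
  have "(2 + 2 * r) * y\<^sup>2 \<le> (2 + 2 * r) * ((3 - 2 * r) * x\<^sup>2)"
    using slope r(2) by (intro mult_left_mono) auto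
  also have "\<dots> = (2 * r - 2) * x\<^sup>2" using r(1) by (simp add: algebra_simps)
  also have "\<dots> \<le> x\<^sup>2 * x\<^sup>2" using x2 by (rule mult_right_mono) simp
  finally have "2 + 2 * r \<le> x ^ 4 / y\<^sup>2"
    using assms(2) by (simp add: pos_le_divide_eq power2_eq_square power4_eq_xxxx mult.assoc)
  then show ?thesis by (simp add: Phi2_def assms(1) r_def)
qed

text \<open>On the unit circle \<open>Phi3 x y = (2 + w)\<^sup>2 / (2 * w)\<close> with \<open>w = (x - y)\<^sup>2\<close>, which decreases for
  \<open>w < 2\<close>; on the line \<open>y = (sqrt 2 - 1) * x\<close> the value of \<open>w\<close> is \<open>1 - sqrt 2 / 2\<close>.\<close>

lemma Phi3_ge:
  assumes "x\<^sup>2 + y\<^sup>2 = 1" "0 \<le> y" "y < x" "(sqrt 2 - 1) * x \<le> y"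
  shows "6 + 2 * sqrt 2 \<le> Phi3 x y"
proof -
  define r where "r = sqrt (2::real)"
  have r: "r * r = 2" "7 / 5 < r" "r < 142 / 100"
    using sqrt2_bounds by (simp_all add: r_def)
  define w where "w = (x - y)\<^sup>2"
  have w_pos: "0 < w" using assms(3) by (simp add: w_def)
  have xy: "2 * x * y = 1 - w"
    unfolding assms(1)[symmetric] w_def by (simp add: power2_eq_square algebra_simps)
  have w_le: "(2 + r) * w \<le> 1"
  proof -
    have "1 * x \<le> (r + 1) * x" using r assms(2,3) by (intro mult_right_mono) auto
    then have "0 \<le> (y - (r - 1) * x) * ((r + 1) * x - y)"
      using assms(3,4) by (intro mult_nonneg_nonneg) (simp_all add: r_def)
    also have "\<dots> = r * (2 * x * y) - (x\<^sup>2 + y\<^sup>2)"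
      using r(1) by (simp add: power2_eq_square algebra_simps)
    finally have "0 \<le> r * (1 - w) - 1" by (simp add: xy assms(1))
    then have "0 \<le> (r + 1) * (r * (1 - w) - 1)" using r(2) by simp
    also have "\<dots> = 1 - (2 + r) * w" using r(1) by (simp add: algebra_simps)
    finally show ?thesis by simp
  qed
  have "(6 + 2 * r) * (2 * w) \<le> 4 + 4 * w + w\<^sup>2"
  proof -
    have "(6 + 2 * r) * (2 * w) = 4 * ((2 + r) * w) + 4 * w" by (simp add: algebra_simps)
    also have "\<dots> \<le> 4 + 4 * w + w\<^sup>2" using w_le zero_le_power2[of w] by linarith
    finally show ?thesis .
  qed
  also have "\<dots> = (2 + w)\<^sup>2" by (simp add: power2_eq_square algebra_simps)
  finally have "6 + 2 * r \<le> (2 + w)\<^sup>2 / (2 * w)"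
    using w_pos by (simp add: pos_le_divide_eq)
  moreover have "3 * x\<^sup>2 - 2 * x * y + 3 * y\<^sup>2 = 2 + w"
    using assms(1) xy by linarith
  ultimately show ?thesis by (simp add: Phi3_def w_def r_def)
qed

section \<open>The pointwise gradient estimate\<close>

text \<open>The form \<open>x\<^sup>2 - 2 * x * y - y\<^sup>2\<close> is \<open>cos \<phi> - sin \<phi>\<close>, and the two middle sectors
  lie well inside the range \<open>\<bar>\<phi> - pi / 4\<bar> \<le> pi / 6\<close>.\<close>

lemma middle_sector:
  assumes "x\<^sup>2 + y\<^sup>2 = 1" "0 \<le> x"
    and "(sqrt 2 - 1) / 2 * x \<le> y" "y \<le> (4 * sqrt 2 - 5) * x"
  shows "\<bar>x\<^sup>2 - y\<^sup>2 - 2 * x * y\<bar> \<le> sqrt 2 / 2"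
proof -
  have "1 / 5 * x \<le> (sqrt 2 - 1) / 2 * x" "(4 * sqrt 2 - 5) * x \<le> 7 / 10 * x"
    using assms(2) sqrt2_bounds by (intro mult_right_mono; simp)+
  then have y: "1 / 5 * x \<le> y" "y \<le> 7 / 10 * x" using assms(3,4) by linarith+
  then have "0 \<le> y" using assms(2) by linarith
  have "1 / 5 * x * x \<le> y * x" "y * y \<le> 7 / 10 * x * y" "y * x \<le> 7 / 10 * x * x"
    using y assms(2) \<open>0 \<le> y\<close> by (blast intro: mult_right_mono)+
  moreover have "\<bar>u - v - 2 * t\<bar> \<le> 7 / 10 * (u + v)"
    if "1 / 5 * u \<le> t" "v \<le> 7 / 10 * t" "t \<le> 7 / 10 * u" "0 \<le> u" "0 \<le> v" for u v t :: real
    unfolding abs_le_iff using that by (simp add: field_simps)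
  ultimately have "\<bar>x\<^sup>2 - y\<^sup>2 - 2 * (x * y)\<bar> \<le> 7 / 10 * (x\<^sup>2 + y\<^sup>2)"
    by (simp add: power2_eq_square mult.commute mult.left_commute)
  then show ?thesis using sqrt2_bounds by (simp add: assms(1) mult.assoc)
qed

theorem theorem2p1:
  fixes x y :: real and P :: "real \<times> real \<Rightarrow> real"
  assumes "(x, y) \<in> D4" and "P \<in> quad_polys"
  shows "norm (gradient P (x, y)) \<le> Phi x y * D4_norm P"
proof -
  note xy = D4_bounds[OF assms(1)]
  have N: "0 \<le> D4_norm P" using abs_le_D4_norm[OF assms(2,1)] by linarith
  show ?thesis
  proof (cases "y \<le> (sqrt 2 - 1) / 2 * x \<or> (4 * sqrt 2 - 5) * x \<le> y")
    case True
    then have "Phi x y = Phi1 x y" using xy by (auto simp: Phi_def)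
    then have "6 + 4 * sqrt 2 \<le> Phi x y" using Phi1_ge[OF xy(1-3) True] by simp
    then show ?thesis
      using gradient_bounds(1)[OF assms] N by (meson mult_right_mono order_trans)
  next
    case False
    then have mid: "(sqrt 2 - 1) / 2 * x < y" "y < (4 * sqrt 2 - 5) * x" by auto
    have "(4 * sqrt 2 - 5) * x \<le> 1 * x" "0 \<le> (sqrt 2 - 1) / 2 * x"
      using xy(4) sqrt2_bounds by (auto intro!: mult_right_mono)
    then have y: "0 < y" "y < x" using mid by linarith+
    have "6 + 2 * sqrt 2 \<le> Phi x y"
    proof (cases "y \<le> (sqrt 2 - 1) * x")
      case True
      then have "Phi x y = Phi2 x y" using False mid by (simp add: Phi_def)
      then show ?thesis using Phi2_ge[OF xy(1) y(1) True] by simp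
    next
      case not_le: False
      then have "Phi x y = Phi3 x y" using False mid by (simp add: Phi_def)
      then show ?thesis using Phi3_ge[OF xy(1,2) y(2)] not_le by simp
    qed
    moreover have "norm (gradient P (x, y)) \<le> (6 + 2 * sqrt 2) * D4_norm P"
      using mid xy by (intro gradient_bounds(2)[OF assms] middle_sector) auto
    ultimately show ?thesis using N by (meson mult_right_mono order_trans)
  qed
qed

end
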